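(* Let $m,n\ge 1$ be integers and let $M=2^b$ for an integer $b$, with $M\ge 4$. Let $\mathbf H\in\mathbb C^{m\times n}$, $v\in\mathbb C^m$, let $x^*\in\mathbb C^n$ have all entries in the $M$-PSK symbol set $\mathcal S_M$, and put $r=\mathbf Hx^*+v$. Define $\mathbf Q=\mathbf H^\dagger\mathbf H$, and $z\in\mathbb C^n$ by $z_i=(x_i^* )^{-1}(\mathbf H^\dagger v)_i$ for $i=1,\dots,n$. If the relaxation (ESDR-Y) built from $\mathbf H$ and $r$ is tight, then $$\mathbf Q+\mathrm{Diag}\big(\mathrm{Re}(z)\big)-\cot\left(\frac{2\pi}{M}\right)\mathrm{Diag}\big(|\mathrm{Im}(z)|\big)\succeq 0 .$$
   Context: Notation: $(\cdot)^\dagger$ is the conjugate transpose and $(\cdot)^{\mathsf T}$ the transpose; $\mathrm{Re},\mathrm{Im},|\cdot|$ act entrywise; $\mathrm{Diag}(u)$ is the diagonal matrix with diagonal $u$; $\mathbf A\succeq\mathbf B$ means that $\mathbf A-\mathbf B$ is positive semidefinite (Hermitian, resp. real symmetric); $\langle \mathbf A,\mathbf B\rangle=\mathrm{Re}(\mathrm{Tr}(\mathbf A^\dagger\mathbf B))$; $\mathbf i$ is the imaginary unit. $M$-PSK symbols: $s_j=e^{\mathbf i\theta_j}$ with $\theta_j=2(j-1)\pi/M$, $j=1,\dots,M$; $\mathcal S_M=\{s_1,\dots,s_M\}$; $s_{R,j}=\mathrm{Re}(s_j)$, $s_{I,j}=\mathrm{Im}(s_j)$. For $j=1,\dots,M$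 let $$\mathbf K_j=\begin{bmatrix}1\\ s_{R,j}\\ s_{I,j}\end{bmatrix}\begin{bmatrix}1\\ s_{R,j}\\ s_{I,j}\end{bmatrix}^{\mathsf T}.$$ Put $\mathbf Q=\mathbf H^\dagger\mathbf H$, $c=-\mathbf H^\dagger r$, and $$\hat{\mathbf Q}=\begin{bmatrix}\mathrm{Re}(\mathbf Q)&-\mathrm{Im}(\mathbf Q)\\ \mathrm{Im}(\mathbf Q)&\mathrm{Re}(\mathbf Q)\end{bmatrix},\qquad \hat c=\begin{bmatrix}\mathrm{Re}(c)\\ \mathrm{Im}(c)\end{bmatrix}.$$ (ESDR-Y) is the semidefinite program in the variables $t=(t_{i,j})\in\mathbb R^{Mn}$, $y\in\mathbb R^{2n}$, $\mathbf Y\in\mathbb R^{2n\times 2n}$ (symmetric): minimize $\langle\hat{\mathbf Q},\mathbf Y\rangle+2\hat c^{\mathsf T}y$ subject to $$\begin{bmatrix}1&y_i&y_{n+i}\\ y_i&Y_{i,i}&Y_{i,n+i}\\ y_{n+i}&Y_{n+i,i}&Y_{n+i,n+i}\end{bmatrix}=\sum_{j=1}^M t_{i,j}\mathbf K_j,\qquad \sum_{j=1}^M t_{i,j}=1,\qquad i=1,\dots,n,$$ $t_{i,j}\ge 0$ for all $i,j$, and $\mathbf Y\succeq yy^{\mathsf T}$. (ESDR-Y) is called tight if $(y,\mathbf Y)=(y^*,y^*(y^* )^{\mathsf T})$ (together with the corresponding $t$), where $y^*=\begin{bmatrix}\mathrm{Re}(x^* )\\ \mathrm{Im}(x^* )\end{bmatrix}$,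 is an optimal solution of it; uniqueness of the optimal solution is not required. *)

theory Defs
  imports "HOL-Analysis.Analysis"
begin

definition adjoint_mat :: "complex^('n::finite)^('m::finite) \<Rightarrow> complex^'m^'n" where
  "adjoint_mat A = (\<chi> i j. cnj (A $ j $ i))"

definition Re_mat :: "complex^('n::finite)^('m::finite) \<Rightarrow> real^'n^'m" where
  "Re_mat A = (\<chi> i j. Re (A $ i $ j))"

definition Im_mat :: "complex^('n::finite)^('m::finite) \<Rightarrow> real^'n^'m" where
  "Im_mat A = (\<chi> i j. Im (A $ i $ j))"

definition Diag :: "'a::zero^('n::finite) \<Rightarrow> 'a^'n^'n" where
  "Diag u = (\<chi> i j. if i = j then u $ i else 0)"

definition outer :: "'a::times^('m::finite) \<Rightarrow> 'a^('n::finite) \<Rightarrow> 'a^'n^'m" where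
  "outer u w = (\<chi> i j. u $ i * w $ j)"

definition complex_mat :: "real^('n::finite)^('m::finite) \<Rightarrow> complex^'n^'m" where
  "complex_mat A = (\<chi> i j. complex_of_real (A $ i $ j))"

definition psd_real :: "real^('n::finite)^'n \<Rightarrow> bool" where
  "psd_real A \<longleftrightarrow> transpose A = A \<and> (\<forall>w. 0 \<le> w \<bullet> (A *v w))"

text \<open>For Hermitian \<open>A\<close> the quadratic form \<open>w\<^sup>\<dagger> A w\<close> is real, so taking its real part loses nothing.\<close>

definition psd_complex :: "complex^('n::finite)^'n \<Rightarrow> bool" where
  "psd_complex A \<longleftrightarrow>
     adjoint_mat A = A \<and> (\<forall>w. 0 \<le> Re (\<Sum>i\<in>UNIV. cnj (w $ i) * (A *v w) $ i))"

definition psk_symbol :: "nat \<Rightarrow> nat \<Rightarrow> complex" where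
  "psk_symbol M j = exp (\<i> * complex_of_real (2 * (real j - 1) * pi / real M))"

definition psk_set :: "nat \<Rightarrow> complex set" where
  "psk_set M = psk_symbol M ` {1..M}"

definition K_mat :: "nat \<Rightarrow> nat \<Rightarrow> real^3^3" where
  "K_mat M j =
     (let k = vector [1, Re (psk_symbol M j), Im (psk_symbol M j)] in outer k k)"

text \<open>Vectors in \<open>\<real>\<^sup>2\<^sup>n\<close> are indexed by the sum type \<open>'n + 'n\<close>: \<open>Inl i\<close> stands
  for the index \<open>i\<close> and \<open>Inr i\<close> for the index \<open>n + i\<close>.\<close>

definition block_vec :: "'a^('n::finite) \<Rightarrow> 'a^'n \<Rightarrow> 'a^('n + 'n)" where
  "block_vec u w = (\<chi> k. case k of Inl i \<Rightarrow> u $ i | Inr i \<Rightarrow> w $ i)"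

definition block_mat ::
  "'a^('n::finite)^'n \<Rightarrow> 'a^'n^'n \<Rightarrow> 'a^'n^'n \<Rightarrow> 'a^'n^'n \<Rightarrow> 'a^('n + 'n)^('n + 'n)" where
  "block_mat A B C D = (\<chi> k l.
     case k of
       Inl i \<Rightarrow> (case l of Inl j \<Rightarrow> A $ i $ j | Inr j \<Rightarrow> B $ i $ j)
     | Inr i \<Rightarrow> (case l of Inl j \<Rightarrow> C $ i $ j | Inr j \<Rightarrow> D $ i $ j))"

definition stack_vec :: "complex^('n::finite) \<Rightarrow> real^('n + 'n)" where
  "stack_vec x = block_vec (\<chi> i. Re (x $ i)) (\<chi> i. Im (x $ i))"

definition Q_mat :: "complex^('n::finite)^('m::finite) \<Rightarrow> complex^'n^'n" where
  "Q_mat H = adjoint_mat H ** H"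

definition c_vec :: "complex^('n::finite)^('m::finite) \<Rightarrow> complex^'m \<Rightarrow> complex^'n" where
  "c_vec H r = - (adjoint_mat H *v r)"

definition Q_hat :: "complex^('n::finite)^('m::finite) \<Rightarrow> real^('n + 'n)^('n + 'n)" where
  "Q_hat H = block_mat (Re_mat (Q_mat H)) (- Im_mat (Q_mat H))
                       (Im_mat (Q_mat H)) (Re_mat (Q_mat H))"

definition c_hat :: "complex^('n::finite)^('m::finite) \<Rightarrow> complex^'m \<Rightarrow> real^('n + 'n)" where
  "c_hat H r = stack_vec (c_vec H r)"

definition esdr_objective ::
  "complex^('n::finite)^('m::finite) \<Rightarrow> complex^'m \<Rightarrow> real^('n + 'n) \<Rightarrow> real^('n + 'n)^('n + 'n) \<Rightarrow> real" where
  "esdr_objective H r y Y = trace (transpose (Q_hat H) ** Y) + 2 * (c_hat H r \<bullet> y)"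

definition esdr_block ::
  "real^('n::finite + 'n) \<Rightarrow> real^('n + 'n)^('n + 'n) \<Rightarrow> 'n \<Rightarrow> real^3^3" where
  "esdr_block y Y i = vector
     [vector [1,         y $ Inl i,           y $ Inr i],
      vector [y $ Inl i, Y $ Inl i $ Inl i,   Y $ Inl i $ Inr i],
      vector [y $ Inr i, Y $ Inr i $ Inl i,   Y $ Inr i $ Inr i]]"

text \<open>The variables \<open>t\<^sub>i\<^sub>,\<^sub>j\<close> are the values \<open>t i j\<close> with \<open>j \<in> {1..M}\<close>; the
  remaining values of \<open>t\<close> play no role.\<close>

definition esdr_feasible ::
  "nat \<Rightarrow> ('n \<Rightarrow> nat \<Rightarrow> real) \<Rightarrow> real^('n::finite + 'n) \<Rightarrow> real^('n + 'n)^('n + 'n) \<Rightarrow> bool" where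
  "esdr_feasible M t y Y \<longleftrightarrow>
     transpose Y = Y \<and>
     (\<forall>i. esdr_block y Y i = (\<Sum>j=1..M. t i j *\<^sub>R K_mat M j)) \<and>
     (\<forall>i. (\<Sum>j=1..M. t i j) = 1) \<and>
     (\<forall>i. \<forall>j\<in>{1..M}. 0 \<le> t i j) \<and>
     psd_real (Y - outer y y)"

definition esdr_optimal ::
  "nat \<Rightarrow> complex^('n::finite)^('m::finite) \<Rightarrow> complex^'m \<Rightarrow>
     ('n \<Rightarrow> nat \<Rightarrow> real) \<Rightarrow> real^('n + 'n) \<Rightarrow> real^('n + 'n)^('n + 'n) \<Rightarrow> bool" where
  "esdr_optimal M H r t y Y \<longleftrightarrow>
     esdr_feasible M t y Y \<and>
     (\<forall>t' y' Y'. esdr_feasible M t' y' Y' \<longrightarrow>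
        esdr_objective H r y Y \<le> esdr_objective H r y' Y')"

definition esdr_tight ::
  "nat \<Rightarrow> complex^('n::finite)^('m::finite) \<Rightarrow> complex^'m \<Rightarrow> complex^'n \<Rightarrow> bool" where
  "esdr_tight M H r x \<longleftrightarrow>
     (\<exists>t. esdr_optimal M H r t (stack_vec x) (outer (stack_vec x) (stack_vec x)))"

end

(*
  A feasible direction at the tight point (y*, y* y*^T) is built for every complex vector w. In each
  coordinate i, a small part of the unit mass at x_i is moved to the two antipodal symbols
  omega x_i and -omega x_i, where omega = exp(+-2 pi i / M) with the sign of Im z_i. Weighting the
  two by the inverse squared distances to x_i makes the second moment about x_i equal to |w_i|^2 times
  the 2x2 identity, which is also the diagonal block of the real rank-two matrix R obtained from w
  and i w. So y* y*^T may be perturbed by R together with the cross terms of y* and the direction d;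
  the objective then grows at the rate 2 w^dagger Q w from R and at the rate
  2 sum_i |w_i|^2 (Re z_i - cot(2 pi / M) |Im z_i|) from d. Optimality makes the total nonnegative,
  which is the claimed semidefiniteness.
*)

theory Submission
  imports Defs
begin

section \<open>Complex vectors and matrices in real block form\<close>

lemma sum_UNIV_Plus:
  "(\<Sum>k\<in>UNIV. f k) = (\<Sum>i\<in>UNIV. f (Inl i)) + (\<Sum>i\<in>UNIV. f (Inr i))"
  for f :: "'a::finite + 'b::finite \<Rightarrow> 'c::comm_monoid_add"
  by (simp add: sum.Plus flip: UNIV_Plus_UNIV)

lemma stack_vec_nth [simp]:
  "stack_vec x $ Inl i = Re (x $ i)" "stack_vec x $ Inr i = Im (x $ i)"
  by (simp_all add: stack_vec_def block_vec_def)

lemma inner_stack_vec: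
  "stack_vec u \<bullet> stack_vec w = Re (\<Sum>i\<in>UNIV. cnj (u $ i) * w $ i)"
  by (simp add: inner_vec_def sum_UNIV_Plus sum.distrib)

text \<open>The block matrix is the real representation of a complex-linear map, so quadratic forms
  in \<open>Q_hat\<close> can be evaluated over the complex numbers.\<close>

lemma Q_hat_stack_vec: "Q_hat H *v stack_vec w = stack_vec (Q_mat H *v w)"
  unfolding vec_eq_iff
proof
  fix k
  show "(Q_hat H *v stack_vec w) $ k = stack_vec (Q_mat H *v w) $ k"
    by (cases k) (simp_all add: matrix_vector_mult_def sum_UNIV_Plus Q_hat_def block_mat_def
        Re_mat_def Im_mat_def sum_subtractf sum_negf sum.distrib algebra_simps)
qed

lemma adjoint_Q_mat: "adjoint_mat (Q_mat H) = Q_mat H"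
  by (simp add: vec_eq_iff adjoint_mat_def Q_mat_def matrix_matrix_mult_def mult.commute)

lemma transpose_Q_hat: "transpose (Q_hat H) = Q_hat H"
proof -
  have c: "cnj (Q_mat H $ j $ i) = Q_mat H $ i $ j" for i j
    using adjoint_Q_mat[of H] by (simp add: adjoint_mat_def vec_eq_iff)
  have re: "Re (Q_mat H $ i $ j) = Re (Q_mat H $ j $ i)"
    and im: "- Im (Q_mat H $ i $ j) = Im (Q_mat H $ j $ i)" for i j
    unfolding c[of i j, symmetric] by simp_all
  have "Q_hat H $ l $ k = Q_hat H $ k $ l" for k l
    by (cases k; cases l; simp add: Q_hat_def block_mat_def Re_mat_def Im_mat_def;
      metis re im minus_minus)
  then show ?thesis
    by (simp add: vec_eq_iff transpose_def)
qed

section \<open>Traces as quadratic forms\<close>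

lemma trace_transpose_mult:
  "trace (transpose A ** B) = (\<Sum>i\<in>UNIV. \<Sum>j\<in>UNIV. A $ i $ j * B $ i $ j)"
  for A B :: "real^'n^'m"
  unfolding trace_def matrix_matrix_mult_def transpose_def
  by simp (rule sum.swap)

lemma trace_transpose_mult_add:
  "trace (transpose A ** (B + C)) = trace (transpose A ** B) + trace (transpose A ** C)"
  for A B C :: "real^'n^'m"
  by (simp add: trace_transpose_mult algebra_simps sum.distrib)

lemma trace_transpose_mult_scaleR:
  "trace (transpose A ** (c *\<^sub>R B)) = c * trace (transpose A ** B)"
  for A B :: "real^'n^'m"
  by (simp add: trace_transpose_mult sum_distrib_left algebra_simps)

lemma trace_transpose_mult_outer:
  "trace (transpose A ** outer u w) = u \<bullet> (A *v w)"
  for A :: "real^'n^'m"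
  by (simp add: trace_transpose_mult outer_def inner_vec_def matrix_vector_mult_def
      sum_distrib_left algebra_simps)

lemma inner_outer_mult: "u \<bullet> (outer a a *v u) = (u \<bullet> a)\<^sup>2"
  for u :: "real^'n"
  by (simp add: outer_def inner_vec_def matrix_vector_mult_def power2_eq_square
      sum_product sum_distrib_left algebra_simps)

lemma inner_Diag_mult: "u \<bullet> (Diag g *v u) = (\<Sum>k\<in>UNIV. g $ k * (u $ k)\<^sup>2)"
  for u :: "real^'n"
  by (simp add: Diag_def inner_vec_def matrix_vector_mult_def power2_eq_square
      if_distrib [where f = "\<lambda>a. a * _"] cong: if_cong) (simp add: algebra_simps)

section \<open>PSK symbols and the moments of an antipodal pair\<close>

text \<open>In this algebraic form closure under products and, for even \<open>M\<close>, under
  negation is immediate.\<close>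

lemma psk_set_eq:
  assumes "M > 0"
  shows "psk_set M = {s. s ^ M = 1}"
proof -
  \<comment> \<open>The numbering of symbols starts at 1, whereas the roots of unity are indexed
    from 0.\<close>
  have "psk_symbol M (Suc j) = cis (2 * pi * real j / real M)" for j
    by (simp add: psk_symbol_def cis_conv_exp algebra_simps)
  then have "psk_set M = (\<lambda>j. cis (2 * pi * real j / real M)) ` {..<M}"
    unfolding psk_set_def image_Suc_lessThan[symmetric] image_image by simp
  also have "\<dots> = {s. s ^ M = 1}"
    using Complex.bij_betw_roots_unity[OF assms] by (simp add: bij_betw_def)
  finally show ?thesis .
qed

text \<open>\<open>psk_dir \<omega>\<close> is the combination of \<open>\<omega> - 1\<close> and \<open>-\<omega> - 1\<close> weighted by the inverse
  squared distances of \<open>\<omega>\<close> and \<open>-\<omega>\<close> from \<open>1\<close>; for \<open>\<omega> = cis \<theta>\<close> it equals \<open>-1 + \<i> cot \<theta>\<close>.\<close>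

definition psk_dir :: "complex \<Rightarrow> complex" where
  "psk_dir \<omega> = Complex (-1) (Re \<omega> / Im \<omega>)"

text \<open>The weights are the inverse squared distances from \<open>x\<close> to the two points.
  These points are the ends of a diameter, so by Thales their differences from \<open>x\<close> are
  orthogonal; normalised, they form an orthonormal basis of the plane, whose outer products sum to
  the identity.\<close>

lemma psk_moments:
  fixes \<omega> x :: complex
  assumes "norm \<omega> = 1" "norm x = 1" "Im \<omega> \<noteq> 0"
  defines "\<alpha> \<equiv> 1 / (2 - 2 * Re \<omega>)" and "\<beta> \<equiv> 1 / (2 + 2 * Re \<omega>)"
  shows "\<alpha> > 0" "\<beta> > 0"
    "\<alpha> *\<^sub>R (\<omega> * x - x) + \<beta> *\<^sub>R (- \<omega> * x - x) = x * psk_dir \<omega>"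
    "\<alpha> * (Re (\<omega> * x - x))\<^sup>2 + \<beta> * (Re (- \<omega> * x - x))\<^sup>2 = 1"
    "\<alpha> * (Im (\<omega> * x - x))\<^sup>2 + \<beta> * (Im (- \<omega> * x - x))\<^sup>2 = 1"
    "\<alpha> * (Re (\<omega> * x - x) * Im (\<omega> * x - x)) + \<beta> * (Re (- \<omega> * x - x) * Im (- \<omega> * x - x)) = 0"
proof -
  obtain c s where \<omega>: "\<omega> = Complex c s" by (cases \<omega>)
  obtain p q where x: "x = Complex p q" by (cases x)
  have cs: "s\<^sup>2 = (1 - c) * (1 + c)" and pq: "q\<^sup>2 = 1 - p\<^sup>2" and s: "s \<noteq> 0"
    using assms(1-3) by (simp_all add: \<omega> x cmod_def algebra_simps power2_eq_square)
  have "s\<^sup>2 > 0" using s by simp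
  then have c2: "c\<^sup>2 < 1" unfolding cs by (simp add: algebra_simps power2_eq_square)
  then have c: "1 - c > 0" "1 + c > 0" by (auto simp: abs_square_less_1 abs_less_iff)
  have \<alpha>: "\<alpha> = 1 / (2 * (1 - c))" and \<beta>: "\<beta> = 1 / (2 * (1 + c))"
    by (simp_all add: \<alpha>_def \<beta>_def \<omega> algebra_simps)
  show "\<alpha> > 0" "\<beta> > 0" using c by (simp_all add: \<alpha> \<beta>)
  have a1: "\<alpha> * (1 - c) = 1 / 2" and b1: "\<beta> * (1 + c) = 1 / 2"
    using c by (simp_all add: \<alpha> \<beta>)
  have as: "\<alpha> * s\<^sup>2 = (1 + c) / 2" and bs: "\<beta> * s\<^sup>2 = (1 - c) / 2"
    using arg_cong[OF a1, of "\<lambda>a. a * (1 + c)"] arg_cong[OF b1, of "\<lambda>a. a * (1 - c)"]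
    by (simp_all add: cs mult_ac)
  have e: "\<alpha> * s - \<beta> * s = c / s"
  proof -
    have "(\<alpha> * s - \<beta> * s) * s = c"
      using as bs by (simp add: algebra_simps power2_eq_square)
    then show ?thesis using s by (simp add: field_simps)
  qed
  show "\<alpha> *\<^sub>R (\<omega> * x - x) + \<beta> *\<^sub>R (- \<omega> * x - x) = x * psk_dir \<omega>"
  proof -
    have "\<alpha> *\<^sub>R (\<omega> - 1) + \<beta> *\<^sub>R (- \<omega> - 1) = psk_dir \<omega>"
      using a1 b1 e by (simp add: psk_dir_def \<omega> complex_eq_iff algebra_simps)
    then have "x * (\<alpha> *\<^sub>R (\<omega> - 1) + \<beta> *\<^sub>R (- \<omega> - 1)) = x * psk_dir \<omega>" by simp
    then show ?thesis by (simp add: algebra_simps)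
  qed
  have parts: "Re (\<omega> * x - x) = (c - 1) * p - s * q" "Re (- \<omega> * x - x) = s * q - (1 + c) * p"
    "Im (\<omega> * x - x) = (c - 1) * q + s * p" "Im (- \<omega> * x - x) = - s * p - (1 + c) * q"
    by (simp_all add: \<omega> x algebra_simps)
  \<comment> \<open>The expansion is arranged so that the weights occur only in the products
    evaluated by \<open>a1\<close>, \<open>b1\<close>, \<open>as\<close> and
    \<open>bs\<close>.\<close>
  have "\<alpha> * ((c - 1) * p - s * q)\<^sup>2 + \<beta> * (s * q - (1 + c) * p)\<^sup>2
      = \<alpha> * (1 - c) * (1 - c) * p\<^sup>2 + \<beta> * (1 + c) * (1 + c) * p\<^sup>2 + (\<alpha> * s\<^sup>2 + \<beta> * s\<^sup>2) * q\<^sup>2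
        + 2 * s * p * q * (\<alpha> * (1 - c) - \<beta> * (1 + c))"
    by (simp add: algebra_simps power2_eq_square)
  also have "\<dots> = 1" unfolding a1 b1 as bs pq by (simp add: field_simps)
  finally show "\<alpha> * (Re (\<omega> * x - x))\<^sup>2 + \<beta> * (Re (- \<omega> * x - x))\<^sup>2 = 1"
    unfolding parts .
  have "\<alpha> * ((c - 1) * q + s * p)\<^sup>2 + \<beta> * (- s * p - (1 + c) * q)\<^sup>2
      = \<alpha> * (1 - c) * (1 - c) * q\<^sup>2 + \<beta> * (1 + c) * (1 + c) * q\<^sup>2 + (\<alpha> * s\<^sup>2 + \<beta> * s\<^sup>2) * p\<^sup>2
        - 2 * s * p * q * (\<alpha> * (1 - c) - \<beta> * (1 + c))"
    by (simp add: algebra_simps power2_eq_square)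
  also have "\<dots> = 1" unfolding a1 b1 as bs pq by (simp add: field_simps)
  finally show "\<alpha> * (Im (\<omega> * x - x))\<^sup>2 + \<beta> * (Im (- \<omega> * x - x))\<^sup>2 = 1"
    unfolding parts .
  have "\<alpha> * (((c - 1) * p - s * q) * ((c - 1) * q + s * p))
        + \<beta> * ((s * q - (1 + c) * p) * (- s * p - (1 + c) * q))
      = p * q * (\<alpha> * (1 - c) * (1 - c) + \<beta> * (1 + c) * (1 + c) - (\<alpha> * s\<^sup>2 + \<beta> * s\<^sup>2))
        - s * p\<^sup>2 * (\<alpha> * (1 - c) - \<beta> * (1 + c)) + s * q\<^sup>2 * (\<alpha> * (1 - c) - \<beta> * (1 + c))"
    by (simp add: algebra_simps power2_eq_square)
  also have "\<dots> = 0" unfolding a1 b1 as bs by (simp add: field_simps)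
  finally show "\<alpha> * (Re (\<omega> * x - x) * Im (\<omega> * x - x))
      + \<beta> * (Re (- \<omega> * x - x) * Im (- \<omega> * x - x)) = 0"
    unfolding parts .
qed


section \<open>Feasibility of the perturbed point\<close>

text \<open>Moving along \<open>d\<close> costs \<open>\<epsilon>\<^sup>2 d d\<^sup>T\<close> in \<open>Y - y y\<^sup>T\<close>, which the rank-two matrix \<open>R\<close> cannot
  absorb. The matrix \<open>D\<close> has the same diagonal \<open>2 \<times> 2\<close> blocks as \<open>R\<close> and dominates
  \<open>d d\<^sup>T\<close> up to a constant, so a small admixture of it restores semidefiniteness.\<close>

lemma esdr_feasible_perturbation:
  fixes x w \<omega> :: "complex^'n"
  assumes M: "M > 0" "even M" and x: "\<And>i. x $ i \<in> psk_set M"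
    and \<omega>: "\<And>i. \<omega> $ i \<in> psk_set M" "\<And>i. Im (\<omega> $ i) \<noteq> 0"
    and \<kappa>: "0 < \<kappa>" "\<kappa> \<le> 1"
  defines "y \<equiv> stack_vec x"
    and "d \<equiv> stack_vec (\<chi> i. (norm (w $ i))\<^sup>2 *\<^sub>R (x $ i * psk_dir (\<omega> $ i)))"
    and "R \<equiv> outer (stack_vec w) (stack_vec w) + outer (stack_vec (\<i> *s w)) (stack_vec (\<i> *s w))"
    and "D \<equiv> Diag (block_vec (\<chi> i. (norm (w $ i))\<^sup>2) (\<chi> i. (norm (w $ i))\<^sup>2))"
  obtains \<epsilon> t where "\<epsilon> > 0"
    "esdr_feasible M t (y + \<epsilon> *\<^sub>R d)
       (outer y y + \<epsilon> *\<^sub>R (outer y d + outer d y + (1 - \<kappa>) *\<^sub>R R + \<kappa> *\<^sub>R D))"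
proof -
  have norm_root: "norm s = 1" if "s \<in> psk_set M" for s
    using that M power_eq_1_iff[of s M] by (simp add: psk_set_eq)
  define g where "g i = (norm (w $ i))\<^sup>2" for i
  have g0: "g i \<ge> 0" for i by (simp add: g_def)
  define \<alpha> where "\<alpha> i = 1 / (2 - 2 * Re (\<omega> $ i))" for i
  define \<beta> where "\<beta> i = 1 / (2 + 2 * Re (\<omega> $ i))" for i
  note mom = psk_moments[OF norm_root[OF \<omega>(1)] norm_root[OF x] \<omega>(2), folded \<alpha>_def \<beta>_def]
  define G where "G = block_vec (\<chi> i. g i) (\<chi> i. g i)"
  have G_nth [simp]: "G $ Inl i = g i" "G $ Inr i = g i" for i
    by (simp_all add: G_def block_vec_def)
  have G0: "G $ k \<ge> 0" for k by (cases k) (simp_all add: g0)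
  have D: "D = Diag G" by (simp add: D_def G_def g_def)
  \<comment> \<open>Splitting the weight \<open>G\<close> off \<open>d\<close> lets Cauchy-Schwarz
    bound \<open>(u \<bullet> d)\<^sup>2\<close> by \<open>S\<close> times the quadratic form of
    \<open>D\<close>.\<close>
  define f where "f = stack_vec (\<chi> i. x $ i * psk_dir (\<omega> $ i))"
  have d: "d $ k = G $ k * f $ k" for k
    by (cases k) (simp_all add: d_def f_def g_def)
  define S where "S = (\<Sum>k\<in>UNIV. G $ k * (f $ k)\<^sup>2)"
  define T where "T = (\<Sum>i\<in>UNIV. g i * (\<alpha> i + \<beta> i))"
  have pos: "g i * (\<alpha> i + \<beta> i) \<ge> 0" for i
    using g0[of i] mom(1,2)[of i] by simp
  have S0: "S \<ge> 0" unfolding S_def by (intro sum_nonneg mult_nonneg_nonneg G0) simp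
  have T0: "T \<ge> 0" unfolding T_def by (intro sum_nonneg pos)
  have T: "g i * (\<alpha> i + \<beta> i) \<le> T" for i
    unfolding T_def by (rule member_le_sum) (use pos in auto)
  \<comment> \<open>Two demands fix the step: \<open>\<epsilon> * S \<le> \<kappa>\<close> for
    semidefiniteness, and \<open>\<epsilon> * T \<le> 1\<close> so that the mass left at each
    \<open>x $ i\<close> stays nonnegative. The summand 1 keeps the denominator positive.\<close>
  define \<epsilon> where "\<epsilon> = \<kappa> / (1 + S + T)"
  have \<epsilon>: "\<epsilon> > 0" using \<kappa> S0 T0 by (simp add: \<epsilon>_def)
  have \<epsilon>S: "\<epsilon> * S \<le> \<kappa>" using \<kappa> S0 T0 by (simp add: \<epsilon>_def field_simps)
  have \<epsilon>T: "\<epsilon> * T \<le> 1"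
  proof -
    have "\<kappa> * T \<le> 1 * T" using \<kappa> T0 by (intro mult_right_mono) auto
    then show ?thesis using S0 T0 by (simp add: \<epsilon>_def field_simps)
  qed
  have "\<forall>i. \<exists>j\<in>{1..M}. x $ i = psk_symbol M j"
    using x by (auto simp: psk_set_def)
  then obtain k where k: "\<And>i. k i \<in> {1..M}" "\<And>i. psk_symbol M (k i) = x $ i"
    by metis
  have "\<omega> $ i * x $ i \<in> psk_set M" "- \<omega> $ i * x $ i \<in> psk_set M" for i
    using x[of i] \<omega>(1)[of i] M by (simp_all add: psk_set_eq power_mult_distrib)
  then have "\<forall>i. \<exists>j\<in>{1..M}. \<omega> $ i * x $ i = psk_symbol M j"
    "\<forall>i. \<exists>j\<in>{1..M}. - \<omega> $ i * x $ i = psk_symbol M j"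
    by (auto simp: psk_set_def image_iff)
  then obtain p q where p: "\<And>i. p i \<in> {1..M}" "\<And>i. psk_symbol M (p i) = \<omega> $ i * x $ i"
    and q: "\<And>i. q i \<in> {1..M}" "\<And>i. psk_symbol M (q i) = - \<omega> $ i * x $ i"
    by metis
  \<comment> \<open>Adding three point masses makes it unnecessary to show that \<open>k i\<close>,
    \<open>p i\<close> and \<open>q i\<close> are distinct.\<close>
  define t where "t i j = (if j = k i then 1 - \<epsilon> * (g i * (\<alpha> i + \<beta> i)) else 0)
    + (if j = p i then \<epsilon> * g i * \<alpha> i else 0) + (if j = q i then \<epsilon> * g i * \<beta> i else 0)" for i j
  have t_sum: "(\<Sum>j=1..M. t i j *\<^sub>R F j) =
      (1 - \<epsilon> * (g i * (\<alpha> i + \<beta> i))) *\<^sub>R F (k i) + (\<epsilon> * g i * \<alpha> i) *\<^sub>R F (p i) + (\<epsilon> * g i * \<beta> i) *\<^sub>R F (q i)"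
    for i and F :: "nat \<Rightarrow> 'z::real_vector"
    using k(1)[of i] p(1)[of i] q(1)[of i]
    by (simp add: t_def scaleR_add_left sum.distrib if_distrib[of "\<lambda>a. a *\<^sub>R _"] cong: if_cong)
  define y' where "y' = y + \<epsilon> *\<^sub>R d"
  define Y' where "Y' = outer y y + \<epsilon> *\<^sub>R (outer y d + outer d y + (1 - \<kappa>) *\<^sub>R R + \<kappa> *\<^sub>R D)"
  have "esdr_feasible M t y' Y'"
    unfolding esdr_feasible_def
  proof (intro conjI allI ballI)
    show sym: "transpose Y' = Y'"
      by (simp add: vec_eq_iff transpose_def Y'_def R_def D Diag_def outer_def algebra_simps)
    show "(\<Sum>j=1..M. t i j) = 1" for i
      using t_sum[of i "\<lambda>_. 1::real"] by (simp add: algebra_simps)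
    show "0 \<le> t i j" for i j
    proof -
      have "\<epsilon> * (g i * (\<alpha> i + \<beta> i)) \<le> \<epsilon> * T"
        using T \<epsilon> by (intro mult_left_mono) auto
      then have "\<epsilon> * (g i * (\<alpha> i + \<beta> i)) \<le> 1" using \<epsilon>T by linarith
      moreover have "\<epsilon> * g i * \<alpha> i \<ge> 0" "\<epsilon> * g i * \<beta> i \<ge> 0"
        using \<epsilon> g0[of i] mom(1,2)[of i] by simp_all
      ultimately show ?thesis unfolding t_def by auto
    qed
    show "esdr_block y' Y' i = (\<Sum>j=1..M. t i j *\<^sub>R K_mat M j)" for i
    proof -
      have g: "g i = (Re (w $ i))\<^sup>2 + (Im (w $ i))\<^sup>2"
        by (simp add: g_def cmod_power2)
      define X where "X = x $ i"
      define U where "U = \<omega> $ i * x $ i - x $ i"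
      define V where "V = - \<omega> $ i * x $ i - x $ i"
      have dl: "d $ Inl i = g i * (\<alpha> i * Re U + \<beta> i * Re V)"
        and dr: "d $ Inr i = g i * (\<alpha> i * Im U + \<beta> i * Im V)"
        using mom(3)[of i, symmetric] by (simp_all add: d_def g_def U_def V_def)
      have yl: "y $ Inl i = Re X" and yr: "y $ Inr i = Im X"
        by (simp_all add: y_def X_def)
      have y'l: "y' $ Inl i = Re X + \<epsilon> * (g i * (\<alpha> i * Re U + \<beta> i * Re V))"
        and y'r: "y' $ Inr i = Im X + \<epsilon> * (g i * (\<alpha> i * Im U + \<beta> i * Im V))"
        by (simp_all add: y'_def dl dr yl yr)
      have R: "R $ Inl i $ Inl i = g i" "R $ Inr i $ Inr i = g i"
        "R $ Inl i $ Inr i = 0" "R $ Inr i $ Inl i = 0"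
        by (simp_all add: R_def outer_def g power2_eq_square)
      have m: "\<alpha> i * (Re U)\<^sup>2 + \<beta> i * (Re V)\<^sup>2 = 1" "\<alpha> i * (Im U)\<^sup>2 + \<beta> i * (Im V)\<^sup>2 = 1"
        "\<alpha> i * (Re U * Im U) + \<beta> i * (Re V * Im V) = 0"
        using mom(4-6)[of i] by (simp_all add: U_def V_def)
      \<comment> \<open>On this block \<open>R\<close> and \<open>D\<close> agree, so
        \<open>\<kappa>\<close> cancels. Their common value is written through the second moments of
        \<open>U\<close> and \<open>V\<close>, which exhibits each entry as the mixture over
        \<open>X\<close>, \<open>X + U\<close> and \<open>X + V\<close> prescribed by
        \<open>t\<close>.\<close>
      have Yll: "Y' $ Inl i $ Inl i = (Re X)\<^sup>2 + \<epsilon> * g i * (2 * Re X * (\<alpha> i * Re U + \<beta> i * Re V)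
          + (\<alpha> i * (Re U)\<^sup>2 + \<beta> i * (Re V)\<^sup>2))"
        unfolding m by (simp add: Y'_def D Diag_def outer_def R dl yl power2_eq_square algebra_simps)
      have Yrr: "Y' $ Inr i $ Inr i = (Im X)\<^sup>2 + \<epsilon> * g i * (2 * Im X * (\<alpha> i * Im U + \<beta> i * Im V)
          + (\<alpha> i * (Im U)\<^sup>2 + \<beta> i * (Im V)\<^sup>2))"
        unfolding m by (simp add: Y'_def D Diag_def outer_def R dr yr power2_eq_square algebra_simps)
      have Ylr: "Y' $ Inl i $ Inr i = Re X * Im X + \<epsilon> * g i * (Re X * (\<alpha> i * Im U + \<beta> i * Im V)
          + Im X * (\<alpha> i * Re U + \<beta> i * Re V) + (\<alpha> i * (Re U * Im U) + \<beta> i * (Re V * Im V)))"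
        unfolding m by (simp add: Y'_def D Diag_def outer_def R dl dr yl yr algebra_simps)
      have Yrl: "Y' $ Inr i $ Inl i = Y' $ Inl i $ Inr i"
        using arg_cong[OF sym, of "\<lambda>A. A $ Inl i $ Inr i"] by (simp add: transpose_def)
      have k': "psk_symbol M (k i) = X" and p': "psk_symbol M (p i) = X + U"
        and q': "psk_symbol M (q i) = X + V"
        by (simp_all add: k(2) p(2) q(2) X_def U_def V_def)
      show ?thesis
        unfolding t_sum
        by (simp add: vec_eq_iff forall_3 esdr_block_def K_mat_def outer_def Let_def k' p' q'
            Yrl Yll Yrr Ylr y'l y'r) (simp add: algebra_simps power2_eq_square)
    qed
    show "psd_real (Y' - outer y' y')"
    proof -
      \<comment> \<open>The terms of order 0 and the cross terms cancel against
        \<open>outer y' y'\<close>; of it only the part quadratic in \<open>d\<close>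
        survives.\<close>
      have eq: "Y' - outer y' y' = \<epsilon> *\<^sub>R ((1 - \<kappa>) *\<^sub>R R + \<kappa> *\<^sub>R D - \<epsilon> *\<^sub>R outer d d)"
        by (simp add: vec_eq_iff Y'_def y'_def outer_def algebra_simps)
      have "0 \<le> u \<bullet> ((Y' - outer y' y') *v u)" for u
      proof -
        let ?N = "\<Sum>k\<in>UNIV. G $ k * (u $ k)\<^sup>2"
        have "u $ k * d $ k = (sqrt (G $ k) * u $ k) * (sqrt (G $ k) * f $ k)" for k
        proof -
          have "(sqrt (G $ k) * u $ k) * (sqrt (G $ k) * f $ k)
              = (sqrt (G $ k) * sqrt (G $ k)) * (u $ k * f $ k)" by (simp only: mult_ac)
          then show ?thesis using G0[of k] by (simp add: d)
        qed
        then have "(u \<bullet> d)\<^sup>2 = (\<Sum>k\<in>UNIV. (sqrt (G $ k) * u $ k) * (sqrt (G $ k) * f $ k))\<^sup>2"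
          by (simp only: inner_vec_def inner_real_def)
        also have "\<dots> \<le> (\<Sum>k\<in>UNIV. (sqrt (G $ k) * u $ k)\<^sup>2) * (\<Sum>k\<in>UNIV. (sqrt (G $ k) * f $ k)\<^sup>2)"
          by (rule Cauchy_Schwarz_ineq_sum)
        also have "\<dots> = ?N * S"
          using G0 by (simp add: power_mult_distrib S_def)
        finally have "\<epsilon> * (u \<bullet> d)\<^sup>2 \<le> \<epsilon> * (?N * S)"
          using \<epsilon> by (intro mult_left_mono) auto
        also have "\<dots> = \<epsilon> * S * ?N" by simp
        also have "\<dots> \<le> \<kappa> * ?N"
          by (intro mult_right_mono \<epsilon>S sum_nonneg mult_nonneg_nonneg G0) simp
        finally have le: "\<epsilon> * (u \<bullet> d)\<^sup>2 \<le> \<kappa> * ?N" .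
        have "u \<bullet> ((Y' - outer y' y') *v u)
            = \<epsilon> * ((1 - \<kappa>) * ((u \<bullet> stack_vec w)\<^sup>2 + (u \<bullet> stack_vec (\<i> *s w))\<^sup>2)
                + (\<kappa> * ?N - \<epsilon> * (u \<bullet> d)\<^sup>2))"
          unfolding eq R_def D
          by (simp add: matrix_vector_mult_add_rdistrib matrix_vector_mult_diff_rdistrib
              scaleR_matrix_vector_assoc[symmetric] inner_add_right inner_diff_right
              inner_outer_mult inner_Diag_mult)
        then show ?thesis using \<epsilon> \<kappa> le by simp
      qed
      moreover have "transpose (Y' - outer y' y') = Y' - outer y' y'"
        unfolding eq
        by (simp add: vec_eq_iff transpose_def R_def D Diag_def outer_def algebra_simps)
      ultimately show ?thesis by (simp add: psd_real_def)
    qed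
  qed
  then show ?thesis using that \<epsilon> unfolding y'_def Y'_def by blast
qed


section \<open>The objective along the direction\<close>

lemma psd_complexI:
  assumes "adjoint_mat A = A"
    and "\<And>w. 0 \<le> stack_vec w \<bullet> stack_vec (A *v w)"
  shows "psd_complex A"
  using assms by (simp add: psd_complex_def inner_stack_vec)

lemma esdr_objective_linear:
  "esdr_objective H r (y + c *\<^sub>R d) (Y + c *\<^sub>R E) =
     esdr_objective H r y Y + c * esdr_objective H r d E"
  unfolding esdr_objective_def
  by (simp add: trace_transpose_mult_add trace_transpose_mult_scaleR inner_add_right algebra_simps)

lemma stack_vec_add: "stack_vec (u + w) = stack_vec u + stack_vec w"
  unfolding vec_eq_iff
proof
  show "stack_vec (u + w) $ k = (stack_vec u + stack_vec w) $ k" for k by (cases k) simp_all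
qed

lemma stack_vec_minus: "stack_vec (- u) = - stack_vec u"
  unfolding vec_eq_iff
proof
  show "stack_vec (- u) $ k = (- stack_vec u) $ k" for k by (cases k) simp_all
qed

text \<open>Multiplication by the imaginary unit is an isometry; hence both halves of
  \<open>R\<close> contribute equally to the objective.\<close>

lemma inner_stack_vec_ii:
  "stack_vec (\<i> *s u) \<bullet> stack_vec (\<i> *s w) = stack_vec u \<bullet> stack_vec w"
  by (simp add: inner_vec_def sum_UNIV_Plus add.commute)

lemma inner_stack_vec_scale:
  "stack_vec w \<bullet> stack_vec (\<chi> i. complex_of_real (a i) * w $ i) =
     (\<Sum>i\<in>UNIV. (norm (w $ i))\<^sup>2 * a i)"
  unfolding inner_stack_vec cmod_power2 Re_sum
  by (simp add: power2_eq_square algebra_simps)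

text \<open>The unit modulus of \<open>x\<close> cancels the rotation, leaving the product of
  \<open>z\<close> with the conjugate of \<open>psk_dir \<omega>\<close>.\<close>

lemma psk_dir_inner:
  assumes "norm x = 1"
  shows "Re (cnj (g *\<^sub>R (x * psk_dir \<omega>)) * (x * z)) = - (g * (Re z - Re \<omega> / Im \<omega> * Im z))"
proof -
  have "cnj x * x = 1" using assms complex_norm_square[of x] by (simp add: mult.commute)
  moreover have "cnj (g *\<^sub>R (x * psk_dir \<omega>)) * (x * z) = g *\<^sub>R ((cnj x * x) * (cnj (psk_dir \<omega>) * z))"
    by (simp add: mult_ac)
  ultimately have "cnj (g *\<^sub>R (x * psk_dir \<omega>)) * (x * z) = g *\<^sub>R (cnj (psk_dir \<omega>) * z)"
    by simp
  then show ?thesis by (simp only:) (simp add: psk_dir_def algebra_simps)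
qed

section \<open>The necessary condition from optimality\<close>

theorem theorem3p4:
  fixes H :: "complex^('n::finite)^('m::finite)" and v r :: "complex^'m" and x z :: "complex^'n"
    and M b :: nat
  assumes "M = 2 ^ b" and "M \<ge> 4"
    and "\<forall>i. x $ i \<in> psk_set M"
    and "r = H *v x + v"
    and "z = (\<chi> i. inverse (x $ i) * (adjoint_mat H *v v) $ i)"
    and "esdr_tight M H r x"
  shows "psd_complex
    (Q_mat H + complex_mat (Diag (\<chi> i. Re (z $ i)))
       - complex_mat (cot (2 * pi / real M) *\<^sub>R Diag (\<chi> i. \<bar>Im (z $ i)\<bar>)))"
proof (rule psd_complexI)
  let ?A = "Q_mat H + complex_mat (Diag (\<chi> i. Re (z $ i)))
       - complex_mat (cot (2 * pi / real M) *\<^sub>R Diag (\<chi> i. \<bar>Im (z $ i)\<bar>))"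
  have "cnj (Q_mat H $ j $ i) = Q_mat H $ i $ j" for i j
    using adjoint_Q_mat[of H] by (simp add: adjoint_mat_def vec_eq_iff)
  then show "adjoint_mat ?A = ?A"
    by (simp add: vec_eq_iff adjoint_mat_def complex_mat_def Diag_def)
  have M: "M > 0" "even M"
    using assms(1,2) by (cases b; simp)+
  have norm_x: "norm (x $ i) = 1" for i
    using assms(3) M power_eq_1_iff[of "x $ i" M] by (simp add: psk_set_eq)
  have sin0: "sin (2 * pi / M) > 0"
    using assms(2) by (intro sin_gt_zero) (auto simp: field_simps)
  \<comment> \<open>The sign of the angle turns the cotangent times \<open>Im (z $ i)\<close> into
    the same multiple of its absolute value.\<close>
  define \<omega> where "\<omega> = (\<chi> i. if Im (z $ i) \<ge> 0 then cis (2 * pi / M) else cis (- (2 * pi / M)))"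
  have "M * (2 * pi / M) = 2 * pi" "M * (- (2 * pi / M)) = - (2 * pi)"
    using M(1) by simp_all
  then have "cis (2 * pi / M) ^ M = 1" "cis (- (2 * pi / M)) ^ M = 1"
    by (simp_all only: Complex.DeMoivre) (simp_all add: complex_eq_iff)
  then have \<omega>: "\<omega> $ i \<in> psk_set M" "Im (\<omega> $ i) \<noteq> 0"
    and \<omega>_cot: "Re (\<omega> $ i) / Im (\<omega> $ i) * Im (z $ i) = cot (2 * pi / M) * \<bar>Im (z $ i)\<bar>" for i
    using M sin0 by (auto simp: \<omega>_def psk_set_eq cot_def)
  define y where "y = stack_vec x"
  obtain t where opt: "esdr_optimal M H r t y (outer y y)"
    using assms(6) unfolding esdr_tight_def y_def by blast
  show "0 \<le> stack_vec w \<bullet> stack_vec (?A *v w)" for w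
  proof -
    define \<delta> where "\<delta> = (\<chi> i. (norm (w $ i))\<^sup>2 *\<^sub>R (x $ i * psk_dir (\<omega> $ i)))"
    define d where "d = stack_vec \<delta>"
    define R where "R = outer (stack_vec w) (stack_vec w) + outer (stack_vec (\<i> *s w)) (stack_vec (\<i> *s w))"
    define D where "D = Diag (block_vec (\<chi> i. (norm (w $ i))\<^sup>2) (\<chi> i. (norm (w $ i))\<^sup>2))"
    define L where "L = esdr_objective H r d (outer y d + outer d y)"
    define q where "q = trace (transpose (Q_hat H) ** R)"
    define e where "e = trace (transpose (Q_hat H) ** D)"
    have ineq: "0 \<le> L + ((1 - \<kappa>) * q + \<kappa> * e)" if \<kappa>: "0 < \<kappa>" "\<kappa> \<le> 1" for \<kappa>
    proof -
      let ?E = "outer y d + outer d y + (1 - \<kappa>) *\<^sub>R R + \<kappa> *\<^sub>R D"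
      obtain \<epsilon> t' where \<epsilon>: "\<epsilon> > 0"
        and feas: "esdr_feasible M t' (y + \<epsilon> *\<^sub>R d) (outer y y + \<epsilon> *\<^sub>R ?E)"
        using esdr_feasible_perturbation[OF M, of x \<omega> \<kappa> w] assms(3) \<omega> \<kappa>
        unfolding y_def d_def \<delta>_def R_def D_def by blast
      then have "0 \<le> \<epsilon> * esdr_objective H r d ?E"
        using opt unfolding esdr_optimal_def by (force simp: esdr_objective_linear)
      then have "0 \<le> esdr_objective H r d ?E" using \<epsilon> by (simp add: zero_le_mult_iff)
      also have "\<dots> = L + ((1 - \<kappa>) * q + \<kappa> * e)"
        by (simp add: L_def q_def e_def esdr_objective_def trace_transpose_mult_add
            trace_transpose_mult_scaleR)
      finally show ?thesis .
    qed
    \<comment> \<open>The step \<open>\<epsilon>\<close>, which depends on \<open>\<kappa>\<close>,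
      has been divided out in \<open>ineq\<close>, so letting \<open>\<kappa>\<close> tend to 0
      removes the auxiliary \<open>D\<close> and leaves \<open>R\<close> alone.\<close>
    have "((\<lambda>\<kappa>. L + ((1 - \<kappa>) * q + \<kappa> * e)) \<longlongrightarrow> L + ((1 - 0) * q + 0 * e)) (at_right 0)"
      by (intro tendsto_intros)
    moreover have "\<forall>\<^sub>F \<kappa> in at_right (0::real). 0 \<le> L + ((1 - \<kappa>) * q + \<kappa> * e)"
      using ineq by (intro eventually_at_rightI[of 0 1]) auto
    ultimately have Lq: "0 \<le> L + q"
      using tendsto_lowerbound[of "\<lambda>\<kappa>. L + ((1 - \<kappa>) * q + \<kappa> * e)" _ "at_right 0" 0] by simp
    have q: "q = 2 * (stack_vec w \<bullet> stack_vec (Q_mat H *v w))"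
      by (simp add: q_def R_def trace_transpose_mult_add trace_transpose_mult_outer
          Q_hat_stack_vec vector_scalar_commute inner_stack_vec_ii)
    \<comment> \<open>Symmetry of \<open>Q_hat\<close> merges the two cross terms, so
      \<open>L\<close> is the derivative of the least-squares objective at \<open>y\<close> along
      \<open>d\<close>.\<close>
    have "y \<bullet> (Q_hat H *v d) = d \<bullet> (Q_hat H *v y)"
      by (metis dot_lmul_matrix inner_commute transpose_Q_hat transpose_matrix_vector)
    then have "L = 2 * (d \<bullet> (Q_hat H *v y + c_hat H r))"
      by (simp add: L_def esdr_objective_def trace_transpose_mult_add trace_transpose_mult_outer
          inner_add_right inner_commute)
    \<comment> \<open>Half the gradient at the true signal: \<open>r\<close> contains
      \<open>H *v x\<close>, which cancels the quadratic part, and only the noise remains.\<close>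
    also have "Q_hat H *v y + c_hat H r = - stack_vec (adjoint_mat H *v v)"
      by (simp add: y_def Q_hat_stack_vec c_hat_def c_vec_def assms(4) Q_mat_def
          matrix_vector_right_distrib matrix_vector_mul_assoc flip: stack_vec_add stack_vec_minus)
    also have "d \<bullet> (- stack_vec (adjoint_mat H *v v)) =
        - (\<Sum>i\<in>UNIV. Re (cnj (\<delta> $ i) * (x $ i * z $ i)))"
    proof -
      have "x $ i \<noteq> 0" for i using norm_x[of i] by auto
      then have "(adjoint_mat H *v v) $ i = x $ i * z $ i" for i
        by (simp add: assms(5))
      then show ?thesis by (simp add: d_def inner_stack_vec)
    qed
    also have "\<dots> = (\<Sum>i\<in>UNIV. (norm (w $ i))\<^sup>2 * (Re (z $ i) - cot (2 * pi / M) * \<bar>Im (z $ i)\<bar>))"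
      unfolding \<delta>_def vec_lambda_beta psk_dir_inner[OF norm_x] \<omega>_cot by (simp add: sum_negf)
    finally have L: "L = 2 * (\<Sum>i\<in>UNIV. (norm (w $ i))\<^sup>2 * (Re (z $ i) - cot (2 * pi / M) * \<bar>Im (z $ i)\<bar>))" .
    have "?A *v w = Q_mat H *v w
        + (\<chi> i. complex_of_real (Re (z $ i) - cot (2 * pi / M) * \<bar>Im (z $ i)\<bar>) * w $ i)"
      by (simp add: vec_eq_iff matrix_vector_mult_def complex_mat_def Diag_def algebra_simps
          sum.distrib sum_subtractf if_distrib[of "\<lambda>a. a * _"] if_distrib[of "\<lambda>a. _ * a"]
          if_distrib[of complex_of_real] cong: if_cong)
    then have "stack_vec w \<bullet> stack_vec (?A *v w) = stack_vec w \<bullet> stack_vec (Q_mat H *v w)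
        + (\<Sum>i\<in>UNIV. (norm (w $ i))\<^sup>2 * (Re (z $ i) - cot (2 * pi / M) * \<bar>Im (z $ i)\<bar>))"
      by (simp only: stack_vec_add inner_add_right inner_stack_vec_scale)
    then show ?thesis using Lq unfolding L q by simp
  qed
qed

end
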